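(* Let $k\in\mathbb N$ and $S\subseteq R^k_{\{0,1\}}$. If $\rho$ is a canonical relation with $\rho\in\langle S\rangle_{\mathrm{qpp}}$ and $\rho\notin\mathrm{EO}_5(S)$, then $\rho$ is not a canonical relation of type (c7). In particular, there are only finitely many relations $\rho$ that are canonical, lie in $\langle S\rangle_{\mathrm{qpp}}$ and do not lie in $\mathrm{EO}_5(S)$.
   Context: $E_k=\{1,\dots,k\}$. $R^k_{\{0,1\}}$ is the set of $k$-sorted relations on $\{0,1\}$: subsets of $\{0,1\}^n$ (predicates) with each variable assigned a sort in $E_k$ (superscripts denote sorts, arithmetic mod 2). $\sigma_\bot$ is the empty $0$-ary relation and $\sigma^i_=$ equality on sort $i$. $\langle S\rangle_{\mathrm{qpp}}$ is the set of relations definable by formulas built from predicates in $S\cup\{\sigma_\bot,\sigma_=^1,\dots,\sigma_=^k\}$ using conjunction, existential and universal quantification only, each variable having one sort and substituted only into positions of that sort. A variable is dummy if the predicate does not depend on it. Elementary operations: (eo1) appending or removing a dummy variable; (eo2) permuting variables; (eo3) identifying the first two variables when they have the same sort; (eo4) composition: for $\rho_1,\rho_2$ whose first variables are non-dummy and of the same sort, $\rho'(x_1,\dots,x_{n-1},y_1,\dots,y_{m-1})=\exists z\,\rho_1(z,x_1,\dots,x_{n-1})\land\rho_2(z,y_1,\dots,y_{m-1})$; (eo5) $\rho'(x_1,\dots,x_{n-1})=\forall y\,\rho(y,x_1,\dots,x_{n-1})$. $\mathrm{EO}_5(S)$ is the set of relations obtainable from elements of $S\cup\{\sigma_\bot,\sigma_=^1,\dots,\sigma_=^k\}$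 by sequences of operations (eo1)–(eo5). A $k$-sorted relation without dummy variables is canonical if, up to order of variables, it equals one of: (c1) $x^i=0\lor y^i=1$; (c2) $x^i=y^i\lor u^j=b$; (c3) $x^i=y^i\lor u^j=v^j$ with $i\ne j$, or $x^i=y^i\lor y^i=z^i$; (c4) $x^i+y^i=1$; (c5) $x^i+y^i=u^j+v^j$; (c6) $x^{s_1}+\dots+x^{s_n}=b$ with $n\ge2$ and $s_1,\dots,s_n$ pairwise distinct; (c7) $\bigvee_{t=1}^{n}\bigvee_{p=1}^{m_t}(x_p^{s_t}=b_t)$ with $s_1,\dots,s_n$ pairwise distinct; here $i,j,s_t\in E_k$ and $b,b_t\in\{0,1\}$. *)

theory Defs
  imports "HOL-Combinatorics.Permutations" "HOL-Library.Z2"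
begin

section \<open>Multi-sorted relations on {0,1}\<close>

text \<open>A multi-sorted relation is given by the list of the sorts of its variables together with
  the set of tuples satisfying it. The arity is the length of the sort list, so there
  are two 0-ary relations, \<open>([], {})\<close> and \<open>([], {[]})\<close>. The domain {0,1} of every sort is the
  two-element field \<^typ>\<open>bit\<close>. Variable positions are counted from 0.\<close>

type_synonym srel = "nat list \<times> bit list set"

definition sorts :: "nat \<Rightarrow> nat set" where
  "sorts k = {1..k}"

definition srels :: "nat \<Rightarrow> srel set" where
  "srels k = {(ss, R). set ss \<subseteq> sorts k \<and> (\<forall>t\<in>R. length t = length ss)}"

definition dummy :: "srel \<Rightarrow> nat \<Rightarrow> bool" where
  "dummy \<rho> p \<longleftrightarrow> p < length (fst \<rho>) \<and>
     (\<forall>t a. length t = length (fst \<rho>) \<longrightarrow> (t[p := a] \<in> snd \<rho> \<longleftrightarrow> t \<in> snd \<rho>))"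

definition permute_rel :: "(nat \<Rightarrow> nat) \<Rightarrow> srel \<Rightarrow> srel" where
  "permute_rel \<pi> \<rho> = (permute_list \<pi> (fst \<rho>), permute_list \<pi> ` snd \<rho>)"

definition sigma_bot :: srel where
  "sigma_bot = ([], {})"

definition sigma_eq :: "nat \<Rightarrow> srel" where
  "sigma_eq i = ([i, i], {[x, y] | x y. x = y})"

definition base_rels :: "nat \<Rightarrow> srel set \<Rightarrow> srel set" where
  "base_rels k S = S \<union> {sigma_bot} \<union> sigma_eq ` sorts k"


section \<open>Quantified positive primitive definability\<close>

datatype qpp_formula =
    Atom srel "nat list"
  | Conj qpp_formula qpp_formula
  | Exi nat qpp_formula
  | Uni nat qpp_formula

text \<open>The function \<open>\<tau>\<close> assigns to every variable, free or bound, its unique sort.\<close>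

fun wf_formula :: "nat \<Rightarrow> srel set \<Rightarrow> (nat \<Rightarrow> nat) \<Rightarrow> qpp_formula \<Rightarrow> bool" where
  "wf_formula k S \<tau> (Atom \<rho> vs) \<longleftrightarrow> \<rho> \<in> base_rels k S \<and> map \<tau> vs = fst \<rho>"
| "wf_formula k S \<tau> (Conj \<phi> \<psi>) \<longleftrightarrow> wf_formula k S \<tau> \<phi> \<and> wf_formula k S \<tau> \<psi>"
| "wf_formula k S \<tau> (Exi v \<phi>) \<longleftrightarrow> \<tau> v \<in> sorts k \<and> wf_formula k S \<tau> \<phi>"
| "wf_formula k S \<tau> (Uni v \<phi>) \<longleftrightarrow> \<tau> v \<in> sorts k \<and> wf_formula k S \<tau> \<phi>"

fun free_vars :: "qpp_formula \<Rightarrow> nat set" where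
  "free_vars (Atom \<rho> vs) = set vs"
| "free_vars (Conj \<phi> \<psi>) = free_vars \<phi> \<union> free_vars \<psi>"
| "free_vars (Exi v \<phi>) = free_vars \<phi> - {v}"
| "free_vars (Uni v \<phi>) = free_vars \<phi> - {v}"

fun sat :: "(nat \<Rightarrow> bit) \<Rightarrow> qpp_formula \<Rightarrow> bool" where
  "sat e (Atom \<rho> vs) \<longleftrightarrow> map e vs \<in> snd \<rho>"
| "sat e (Conj \<phi> \<psi>) \<longleftrightarrow> sat e \<phi> \<and> sat e \<psi>"
| "sat e (Exi v \<phi>) \<longleftrightarrow> (\<exists>a. sat (e(v := a)) \<phi>)"
| "sat e (Uni v \<phi>) \<longleftrightarrow> (\<forall>a. sat (e(v := a)) \<phi>)"

text \<open>The list \<open>xs\<close> contains the distinct variables of the defined relation, in order. Some of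
  them may fail to occur in the formula.\<close>

definition qpp :: "nat \<Rightarrow> srel set \<Rightarrow> srel set" where
  "qpp k S = {(map \<tau> xs, {map e xs | e. sat e \<phi>}) | \<tau> xs \<phi>.
     distinct xs \<and> \<tau> ` set xs \<subseteq> sorts k \<and> free_vars \<phi> \<subseteq> set xs \<and> wf_formula k S \<tau> \<phi>}"


section \<open>Elementary operations\<close>

inductive_set EO5 :: "nat \<Rightarrow> srel set \<Rightarrow> srel set" for k :: nat and S :: "srel set" where
  base: "\<rho> \<in> base_rels k S \<Longrightarrow> \<rho> \<in> EO5 k S"
| eo1_append: "(ss, R) \<in> EO5 k S \<Longrightarrow> i \<in> sorts k \<Longrightarrow>
    (ss @ [i], {t @ [a] | t a. t \<in> R}) \<in> EO5 k S"
| eo1_remove: "(ss, R) \<in> EO5 k S \<Longrightarrow> dummy (ss, R) p \<Longrightarrow>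
    (take p ss @ drop (Suc p) ss, {take p t @ drop (Suc p) t | t. t \<in> R}) \<in> EO5 k S"
| eo2: "\<rho> \<in> EO5 k S \<Longrightarrow> \<pi> permutes {..<length (fst \<rho>)} \<Longrightarrow> permute_rel \<pi> \<rho> \<in> EO5 k S"
| eo3: "(i # i # ss, R) \<in> EO5 k S \<Longrightarrow> (i # ss, {a # t | a t. a # a # t \<in> R}) \<in> EO5 k S"
| eo4: "(i # ss\<^sub>1, R\<^sub>1) \<in> EO5 k S \<Longrightarrow> (i # ss\<^sub>2, R\<^sub>2) \<in> EO5 k S \<Longrightarrow>
    \<not> dummy (i # ss\<^sub>1, R\<^sub>1) 0 \<Longrightarrow> \<not> dummy (i # ss\<^sub>2, R\<^sub>2) 0 \<Longrightarrow>
    (ss\<^sub>1 @ ss\<^sub>2, {t @ u | t u. \<exists>z. z # t \<in> R\<^sub>1 \<and> z # u \<in> R\<^sub>2}) \<in> EO5 k S"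
| eo5: "(i # ss, R) \<in> EO5 k S \<Longrightarrow> (ss, {t. \<forall>a. a # t \<in> R}) \<in> EO5 k S"


section \<open>Canonical relations\<close>

text \<open>The sets \<open>c1\<close>, ..., \<open>c7\<close> contain the relations of each type with the variables in the
  displayed order. Different letters denote different variables.\<close>

definition c1 :: "nat \<Rightarrow> srel set" where
  "c1 k = {([i, i], {[x, y] | x y. x = 0 \<or> y = 1}) | i. i \<in> sorts k}"

definition c2 :: "nat \<Rightarrow> srel set" where
  "c2 k = {([i, i, j], {[x, y, u] | x y u. x = y \<or> u = b}) | i j b. i \<in> sorts k \<and> j \<in> sorts k}"

definition c3 :: "nat \<Rightarrow> srel set" where
  "c3 k =
     {([i, i, j, j], {[x, y, u, v] | x y u v. x = y \<or> u = v}) | i j.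
        i \<in> sorts k \<and> j \<in> sorts k \<and> i \<noteq> j}
     \<union> {([i, i, i], {[x, y, z] | x y z. x = y \<or> y = z}) | i. i \<in> sorts k}"

definition c4 :: "nat \<Rightarrow> srel set" where
  "c4 k = {([i, i], {[x, y] | x y. x + y = 1}) | i. i \<in> sorts k}"

definition c5 :: "nat \<Rightarrow> srel set" where
  "c5 k = {([i, i, j, j], {[x, y, u, v] | x y u v. x + y = u + v}) | i j.
     i \<in> sorts k \<and> j \<in> sorts k}"

definition c6 :: "nat \<Rightarrow> srel set" where
  "c6 k = {(ss, {t. length t = length ss \<and> sum_list t = b}) | ss b.
     length ss \<ge> 2 \<and> distinct ss \<and> set ss \<subseteq> sorts k}"

text \<open>In type (c7), \<open>x t p\<close> is the value of the \<open>p\<close>-th variable of sort \<open>s t\<close>; the variables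
  are listed block by block.\<close>

definition c7 :: "nat \<Rightarrow> srel set" where
  "c7 k = {(concat (map (\<lambda>t. replicate (m t) (s t)) [0..<n]),
            {concat (map (\<lambda>t. map (x t) [0..<m t]) [0..<n]) | x. \<exists>t<n. \<exists>p<m t. x t p = b t})
     | (n::nat) (m :: nat \<Rightarrow> nat) (s :: nat \<Rightarrow> nat) (b :: nat \<Rightarrow> bit).
        n \<ge> 1 \<and> (\<forall>t<n. m t \<ge> 1) \<and> inj_on s {..<n} \<and> s ` {..<n} \<subseteq> sorts k}"

definition up_to_order :: "srel set \<Rightarrow> srel set" where
  "up_to_order C = {permute_rel \<pi> \<rho> | \<pi> \<rho>. \<rho> \<in> C \<and> \<pi> permutes {..<length (fst \<rho>)}}"

definition canonical :: "nat \<Rightarrow> srel \<Rightarrow> bool" where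
  "canonical k \<rho> \<longleftrightarrow> \<rho> \<in> srels k \<and> (\<forall>p. \<not> dummy \<rho> p) \<and>
     \<rho> \<in> up_to_order (c1 k \<union> c2 k \<union> c3 k \<union> c4 k \<union> c5 k \<union> c6 k \<union> c7 k)"

definition canonical_c7 :: "nat \<Rightarrow> srel \<Rightarrow> bool" where
  "canonical_c7 k \<rho> \<longleftrightarrow> canonical k \<rho> \<and> \<rho> \<in> up_to_order (c7 k)"

end

theory Submission
  imports Defs
begin

text \<open>Every relation in \<open>qpp k S\<close> is a conjunction of relations from \<open>EO5 k S\<close>. This is shown
  by induction on the formula: if \<open>\<phi>\<close> fails at an assignment, some \<open>EO5\<close> constraint implied by
  \<open>\<phi>\<close> fails there too. For \<open>\<exists>v. \<phi>\<close> one such constraint for each of the two values of \<open>v\<close>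
  suffices, and these two are merged by a single composition; so the binary operation (eo4)
  replaces unrestricted conjunction under \<open>\<exists>\<close> because the domain has two elements. A relation of
  type (c7) excludes exactly one tuple, so any proper relation containing it equals it; hence
  it is itself one of the conjuncts. Types (c1) to (c6) contribute finitely many relations for
  fixed \<open>k\<close>.\<close>

section \<open>Constraints from EO5\<close>

lemma permute_list_inj:
  assumes "\<pi> permutes {..<length t}" "length t = length u" "permute_list \<pi> t = permute_list \<pi> u"
  shows "t = u"
proof (rule nth_equalityI)
  fix i assume "i < length t"
  then obtain j where j: "j < length t" "\<pi> j = i"
    using assms(1) by (metis lessThan_iff permutes_def permutes_in_image)
  then show "t ! i = u ! i"
    using assms by (metis permute_list_nth)
qed (use assms in simp)

lemma permute_list_surj:
  assumes "\<pi> permutes {..<length t}"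
  obtains u where "length u = length t" "permute_list \<pi> u = t"
proof
  have inv: "inv \<pi> permutes {..<length t}"
    using assms by (rule permutes_inv)
  show "length (permute_list (inv \<pi>) t) = length t" by simp
  have "permute_list (inv \<pi> \<circ> \<pi>) t = permute_list \<pi> (permute_list (inv \<pi>) t)"
    using assms by (rule permute_list_compose)
  then show "permute_list \<pi> (permute_list (inv \<pi>) t) = t"
    using assms by (simp add: permutes_inv_o)
qed

text \<open>Keeps tuples aligned with their sort lists, so that a concatenated tuple produced by
  (eo4) can be split at a known position and \<open>permute_list\<close> can be inverted.\<close>

lemma EO5_length:
  assumes "S \<subseteq> srels k" "\<rho> \<in> EO5 k S" "t \<in> snd \<rho>"
  shows "length t = length (fst \<rho>)"
  using assms(2,3)
proof (induction arbitrary: t)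
  case (base \<rho>)
  then show ?case
    using assms(1) by (auto simp: base_rels_def sigma_bot_def sigma_eq_def srels_def)
next
  case (eo1_remove ss R p)
  then show ?case by (fastforce simp: dummy_def)
next
  case (eo4 i ss1 R1 ss2 R2)
  then show ?case by fastforce
next
  case (eo5 i ss R)
  then show ?case by fastforce
next
  case (eo2 \<rho> \<pi>)
  then show ?case by (auto simp: permute_rel_def)
qed fastforce+

text \<open>Constraints become predicates on assignments, so formulas over different variable lists
  can be compared directly. Repetitions in \<open>vs\<close> are allowed, since an atom may use a
  variable several times.\<close>

definition represents ::
  "nat \<Rightarrow> srel set \<Rightarrow> (nat \<Rightarrow> nat) \<Rightarrow> nat list \<Rightarrow> ((nat \<Rightarrow> bit) \<Rightarrow> bool) \<Rightarrow> bool" where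
  "represents k S \<tau> vs P \<longleftrightarrow> (\<exists>R. (map \<tau> vs, R) \<in> EO5 k S \<and> (\<forall>e. P e \<longleftrightarrow> map e vs \<in> R))"

lemma represents_permute:
  assumes S: "S \<subseteq> srels k" and P: "represents k S \<tau> vs P" and eq: "mset ws = mset vs"
  shows "represents k S \<tau> ws P"
proof -
  obtain R where R: "(map \<tau> vs, R) \<in> EO5 k S" "\<And>e. P e \<longleftrightarrow> map e vs \<in> R"
    using P by (auto simp: represents_def)
  obtain \<pi> where \<pi>: "\<pi> permutes {..<length vs}" "permute_list \<pi> vs = ws"
    using mset_eq_permutation[OF eq] by blast
  have map: "permute_list \<pi> (map f vs) = map f ws" for f :: "nat \<Rightarrow> 'c"
    using permute_list_map[OF \<pi>(1)] \<pi>(2) by simp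
  have "permute_rel \<pi> (map \<tau> vs, R) \<in> EO5 k S"
    using R(1) \<pi>(1) by (intro eo2) auto
  then have "(map \<tau> ws, permute_list \<pi> ` R) \<in> EO5 k S"
    by (simp add: permute_rel_def map)
  moreover have "map e vs \<in> R \<longleftrightarrow> map e ws \<in> permute_list \<pi> ` R" for e
  proof
    assume "map e ws \<in> permute_list \<pi> ` R"
    then obtain u where u: "u \<in> R" "permute_list \<pi> (map e vs) = permute_list \<pi> u"
      unfolding map by auto
    have "length u = length vs"
      using EO5_length[OF S R(1)] u(1) by simp
    then show "map e vs \<in> R"
      using permute_list_inj[of \<pi> "map e vs" u] \<pi>(1) u by simp
  qed (metis map imageI)
  ultimately show ?thesis
    using R(2) by (auto simp: represents_def)
qed

text \<open>Two copies of a repeated variable are brought to the front and merged by (eo3); each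
  merge shortens the list.\<close>

lemma represents_distinct:
  assumes S: "S \<subseteq> srels k" and P: "represents k S \<tau> vs P"
  shows "\<exists>ws. distinct ws \<and> set ws = set vs \<and> represents k S \<tau> ws P"
  using P
proof (induction "length vs" arbitrary: vs rule: less_induct)
  case less
  show ?case
  proof (cases "distinct vs")
    case True
    then show ?thesis using less.prems by blast
  next
    case False
    then obtain xs ys zs y where vs: "vs = xs @ [y] @ ys @ [y] @ zs"
      using not_distinct_decomp by blast
    let ?ws = "xs @ ys @ zs"
    have "represents k S \<tau> (y # y # ?ws) P"
      by (rule represents_permute[OF S less.prems]) (simp add: vs)
    then obtain R where R: "(\<tau> y # \<tau> y # map \<tau> ?ws, R) \<in> EO5 k S"
        "\<And>e. P e \<longleftrightarrow> e y # e y # map e ?ws \<in> R"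
      by (auto simp: represents_def)
    have "represents k S \<tau> (y # ?ws) P"
      unfolding represents_def using eo3[OF R(1)] R(2)
      by (intro exI[of _ "{a # t | a t. a # a # t \<in> R}"]) simp
    from less.hyps[OF _ this] show ?thesis
      by (auto simp: vs)
  qed
qed

lemma represents_cong:
  assumes "represents k S \<tau> vs P" "\<And>v. v \<in> set vs \<Longrightarrow> e v = e' v"
  shows "P e \<longleftrightarrow> P e'"
  using assms by (auto simp: represents_def cong: map_cong)

text \<open>Prepares a constraint for quantification over \<open>v\<close>. Since (eo4) demands a
  non-dummy first variable, a dummy \<open>v\<close> is deleted by (eo1), which leads to the case
  \<open>free\<close>.\<close>

lemma represents_cases [consumes 2, case_names free head]:
  assumes S: "S \<subseteq> srels k" and P: "represents k S \<tau> vs P"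
  obtains (free) ws where "set ws \<subseteq> set vs - {v}" "represents k S \<tau> ws P"
  | (head) ws R where "set ws \<subseteq> set vs - {v}" "(\<tau> v # map \<tau> ws, R) \<in> EO5 k S"
      "\<not> dummy (\<tau> v # map \<tau> ws, R) 0" "\<And>e. P e \<longleftrightarrow> e v # map e ws \<in> R"
proof -
  obtain us where us: "distinct us" "set us = set vs" "represents k S \<tau> us P"
    using represents_distinct[OF S P] by blast
  show thesis
  proof (cases "v \<in> set us")
    case False
    then show thesis using us free by blast
  next
    case True
    let ?ws = "remove1 v us"
    have ws: "set ?ws \<subseteq> set vs - {v}"
      using us by simp
    have "represents k S \<tau> (v # ?ws) P"
      by (rule represents_permute[OF S us(3)]) (use True in simp)
    then obtain R where R: "(\<tau> v # map \<tau> ?ws, R) \<in> EO5 k S"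
        "\<And>e. P e \<longleftrightarrow> e v # map e ?ws \<in> R"
      by (auto simp: represents_def)
    show thesis
    proof (cases "dummy (\<tau> v # map \<tau> ?ws, R) 0")
      case False
      then show thesis using head[OF ws R(1)] R(2) by blast
    next
      case True
      \<comment> \<open>This is the tail set of \<open>R\<close>, written as (eo1) yields it for
        position 0.\<close>
      let ?R = "{take 0 t @ drop (Suc 0) t | t. t \<in> R}"
      have "(map \<tau> ?ws, ?R) \<in> EO5 k S"
        using eo1_remove[OF R(1) True] by simp
      moreover have "e v # map e ?ws \<in> R \<longleftrightarrow> map e ?ws \<in> ?R" for e
      proof
        assume "e v # map e ?ws \<in> R"
        then show "map e ?ws \<in> ?R" by force
      next
        assume "map e ?ws \<in> ?R"
        then obtain t where t: "t \<in> R" "map e ?ws = drop (Suc 0) t" by auto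
        moreover have "length t = Suc (length ?ws)"
          using EO5_length[OF S R(1)] t(1) by simp
        ultimately obtain a where a: "a # map e ?ws \<in> R"
          by (cases t) auto
        \<comment> \<open>Dummyness lets the unknown head \<open>a\<close> be replaced by
          \<open>e v\<close>.\<close>
        then show "e v # map e ?ws \<in> R"
          using True unfolding dummy_def
          by (metis fst_conv length_Cons length_map list_update_code(2) snd_conv)
      qed
      ultimately have "represents k S \<tau> ?ws P"
        using R(2) unfolding represents_def by blast
      then show thesis using free ws by blast
    qed
  qed
qed

section \<open>Formulas are conjunctions of constraints\<close>

lemma bit_cases_ex: "(\<exists>a::bit. P a) \<longleftrightarrow> P 0 \<or> P 1"
  by (metis bit.exhaust)

text \<open>The constraint may depend on \<open>e\<close>, so a conjunction requires no operation:
  the constraint obtained for a failing conjunct serves.\<close>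

lemma unsat_separated:
  assumes S: "S \<subseteq> srels k" and "wf_formula k S \<tau> \<phi>" "\<not> sat e \<phi>"
  shows "\<exists>vs P. set vs \<subseteq> free_vars \<phi> \<and> represents k S \<tau> vs P \<and> \<not> P e \<and> (\<forall>e'. sat e' \<phi> \<longrightarrow> P e')"
  using assms(2,3)
proof (induction \<phi> arbitrary: e)
  case (Atom \<rho> vs)
  then have "represents k S \<tau> vs (\<lambda>e. map e vs \<in> snd \<rho>)"
    unfolding represents_def by (intro exI[of _ "snd \<rho>"]) (simp add: base)
  with Atom.prems show ?case
    by (intro exI[of _ vs] exI[of _ "\<lambda>e. map e vs \<in> snd \<rho>"]) simp
next
  case (Conj \<phi> \<psi>)
  then consider "\<not> sat e \<phi>" | "\<not> sat e \<psi>" by auto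
  then show ?case
  proof cases
    case 1
    with Conj.IH(1)[of e] Conj.prems(1) show ?thesis by fastforce
  next
    case 2
    with Conj.IH(2)[of e] Conj.prems(1) show ?thesis by fastforce
  qed
next
  case (Exi v \<phi>)
  have sep: "\<exists>vs P. set vs \<subseteq> free_vars \<phi> \<and> represents k S \<tau> vs P \<and> \<not> P (e(v := a))
      \<and> (\<forall>e'. sat e' \<phi> \<longrightarrow> P e')" for a
    using Exi by simp
  \<comment> \<open>A constraint that does not mention \<open>v\<close> cannot see the update of
    \<open>v\<close>: it already fails at \<open>e\<close> and is implied by the existential
    formula.\<close>
  have free_case: ?case if "set ws \<subseteq> free_vars \<phi> - {v}" "represents k S \<tau> ws P" "\<not> P (e(v := a))"
      "\<forall>e'. sat e' \<phi> \<longrightarrow> P e'" for ws P a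
  proof -
    have "P (e'(v := b)) \<longleftrightarrow> P e'" for e' b
      by (rule represents_cong[OF that(2)]) (use that(1) in auto)
    with that show ?thesis by (intro exI[of _ ws] exI[of _ P]) auto
  qed
  obtain vs0 P0 where P0: "set vs0 \<subseteq> free_vars \<phi>" "represents k S \<tau> vs0 P0" "\<not> P0 (e(v := 0))"
      "\<forall>e'. sat e' \<phi> \<longrightarrow> P0 e'"
    using sep[of 0] by blast
  obtain vs1 P1 where P1: "set vs1 \<subseteq> free_vars \<phi>" "represents k S \<tau> vs1 P1" "\<not> P1 (e(v := 1))"
      "\<forall>e'. sat e' \<phi> \<longrightarrow> P1 e'"
    using sep[of 1] by blast
  from S P0(2) show ?case
  proof (cases rule: represents_cases[where v = v])
    case (free ws)
    then show ?thesis using free_case[of ws P0 0] P0 by blast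
  next
    case head0: (head ws0 R0)
    from S P1(2) show ?thesis
    proof (cases rule: represents_cases[where v = v])
      case (free ws)
      then show ?thesis using free_case[of ws P1 1] P1 by blast
    next
      case head1: (head ws1 R1)
      let ?R = "{t @ u | t u. \<exists>z. z # t \<in> R0 \<and> z # u \<in> R1}"
      let ?P = "\<lambda>e. map e (ws0 @ ws1) \<in> ?R"
      \<comment> \<open>Both constraints share \<open>v\<close>, and neither remaining list contains
        it, so (eo4) expresses exactly their joint existential quantification.\<close>
      have P: "?P e' \<longleftrightarrow> (\<exists>z. P0 (e'(v := z)) \<and> P1 (e'(v := z)))" for e'
      proof -
        have eq: "map (e'(v := z)) ws0 = map e' ws0" "map (e'(v := z)) ws1 = map e' ws1" for z
          using head0(1) head1(1) by (auto intro!: map_cong)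
        have "(\<exists>z. P0 (e'(v := z)) \<and> P1 (e'(v := z)))
            \<longleftrightarrow> (\<exists>z. z # map e' ws0 \<in> R0 \<and> z # map e' ws1 \<in> R1)"
          by (simp only: head0(4) head1(4) eq fun_upd_same)
        also have "\<dots> \<longleftrightarrow> ?P e'"
        proof
          assume "?P e'"
          then obtain t u z where tu: "map e' ws0 @ map e' ws1 = t @ u" "z # t \<in> R0" "z # u \<in> R1"
            by auto
          \<comment> \<open>The length fixes where the concatenated tuple splits, so
            \<open>t\<close> and \<open>u\<close> are the two intended value lists.\<close>
          moreover have "length t = length ws0"
            using EO5_length[OF S head0(2)] tu(2) by fastforce
          ultimately show "\<exists>z. z # map e' ws0 \<in> R0 \<and> z # map e' ws1 \<in> R1"
            by auto
        qed auto
        finally show ?thesis by blast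
      qed
      have "(map \<tau> ws0 @ map \<tau> ws1, ?R) \<in> EO5 k S"
        using head0 head1 by (intro eo4) auto
      then have "represents k S \<tau> (ws0 @ ws1) ?P"
        unfolding represents_def by (intro exI[of _ ?R]) simp
      \<comment> \<open>The witness 0 is ruled out by \<open>P0\<close> and the witness 1 by
        \<open>P1\<close>.\<close>
      moreover have "\<not> ?P e"
        unfolding P using P0(3) P1(3) by (simp add: bit_cases_ex)
      moreover have "\<forall>e'. sat e' (Exi v \<phi>) \<longrightarrow> ?P e'"
        unfolding P using P0(4) P1(4) by auto
      moreover have "set (ws0 @ ws1) \<subseteq> free_vars (Exi v \<phi>)"
        using head0(1) head1(1) P0(1) P1(1) by auto
      ultimately show ?thesis by blast
    qed
  qed
next
  case (Uni v \<phi>)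
  then obtain a where "\<not> sat (e(v := a)) \<phi>" by auto
  with Uni obtain vs P where P: "set vs \<subseteq> free_vars \<phi>" "represents k S \<tau> vs P" "\<not> P (e(v := a))"
      "\<forall>e'. sat e' \<phi> \<longrightarrow> P e'"
    by (metis wf_formula.simps(4))
  from S P(2) show ?case
  proof (cases rule: represents_cases[where v = v])
    case (free ws)
    have "P (e'(v := b)) \<longleftrightarrow> P e'" for e' b
      by (rule represents_cong[OF free(2)]) (use free(1) in auto)
    with free P show ?thesis by (intro exI[of _ ws] exI[of _ P]) auto
  next
    \<comment> \<open>Quantifying the constraint universally by (eo5) preserves the implication, and
      the value \<open>a\<close> still refutes it at \<open>e\<close>.\<close>
    case (head ws R)
    let ?R = "{t. \<forall>a. a # t \<in> R}"
    let ?P = "\<lambda>e. map e ws \<in> ?R"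
    have ws: "map (e'(v := z)) ws = map e' ws" for e' :: "nat \<Rightarrow> bit" and z
      using head(1) by (auto intro!: map_cong)
    have eq: "?P e' \<longleftrightarrow> (\<forall>z. P (e'(v := z)))" for e'
      by (simp only: head(4) ws fun_upd_same mem_Collect_eq)
    have "represents k S \<tau> ws ?P"
      unfolding represents_def using eo5[OF head(2)] by (intro exI[of _ ?R]) simp
    moreover have "\<not> ?P e" "\<forall>e'. sat e' (Uni v \<phi>) \<longrightarrow> ?P e'"
      unfolding eq using P(3,4) by auto
    moreover have "set ws \<subseteq> free_vars (Uni v \<phi>)"
      using head(1) P(1) by auto
    ultimately show ?thesis by blast
  qed
qed

section \<open>Relations excluding a single tuple\<close>

text \<open>A separating constraint at the one missing tuple \<open>c\<close> holds on the whole
  relation and fails at \<open>c\<close>, which leaves no freedom: it defines the relation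
  itself.\<close>

lemma qpp_coatom_in_EO5:
  assumes S: "S \<subseteq> srels k" and \<rho>: "\<rho> \<in> qpp k S"
    and c: "length c = length (fst \<rho>)" "snd \<rho> = {t. length t = length (fst \<rho>) \<and> t \<noteq> c}"
  shows "\<rho> \<in> EO5 k S"
proof -
  obtain \<tau> xs \<phi> where \<rho>_eq: "\<rho> = (map \<tau> xs, {map e xs | e. sat e \<phi>})"
    and xs: "distinct xs" "free_vars \<phi> \<subseteq> set xs" and wf: "wf_formula k S \<tau> \<phi>"
    using \<rho> by (auto simp: qpp_def)
  \<comment> \<open>Distinctness of \<open>xs\<close> makes every tuple of the right length the
    value list of some assignment, read off from \<open>zip xs t\<close>.\<close>
  have assignment: "\<exists>e. map e xs = t" if "length t = length xs" for t :: "bit list"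
  proof
    show "map (the \<circ> map_of (zip xs t)) xs = t"
      using that xs(1) by (intro nth_equalityI) (simp_all add: map_of_zip_nth)
  qed
  have len: "length c = length xs" and ex: "{map e xs | e. sat e \<phi>} = {t. length t = length xs \<and> t \<noteq> c}"
    using c by (simp_all add: \<rho>_eq)
  obtain e where e: "map e xs = c"
    using assignment len by blast
  have "\<not> sat e \<phi>"
    using ex e by blast
  then obtain vs0 P where P: "set vs0 \<subseteq> free_vars \<phi>" "represents k S \<tau> vs0 P" "\<not> P e"
      "\<forall>e'. sat e' \<phi> \<longrightarrow> P e'"
    using unsat_separated[OF S wf] by blast
  obtain vs where vs: "distinct vs" "set vs = set vs0" "represents k S \<tau> vs P"
    using represents_distinct[OF S P(2)] by blast
  have cong: "P e1 \<longleftrightarrow> P e2" if "map e1 xs = map e2 xs" for e1 e2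
    by (rule represents_cong[OF vs(3)]) (use that vs(2) P(1) xs(2) in \<open>auto simp: map_eq_conv\<close>)
  have P_iff: "P e' \<longleftrightarrow> map e' xs \<noteq> c" for e'
  proof
    assume "map e' xs \<noteq> c"
    then have "map e' xs \<in> {map e xs | e. sat e \<phi>}"
      unfolding ex by simp
    then obtain e'' where "map e' xs = map e'' xs" "sat e'' \<phi>" by auto
    with P(4) cong show "P e'" by blast
  qed (use cong e P(3) in metis)
  \<comment> \<open>The constraint depends on every variable: flipping one value of \<open>c\<close>
    gives a tuple of the relation, where \<open>P\<close> holds, whereas a variable outside
    \<open>vs\<close> could be flipped without changing \<open>P\<close>.\<close>
  have "set xs \<subseteq> set vs"
  proof
    fix x assume x: "x \<in> set xs"
    show "x \<in> set vs"
    proof (rule ccontr)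
      assume "x \<notin> set vs"
      then have "P (e(x := e x + 1)) \<longleftrightarrow> P e"
        by (intro represents_cong[OF vs(3)]) auto
      then have "map (e(x := e x + 1)) xs = map e xs"
        using P_iff e by simp
      with x have "(e(x := e x + 1)) x = e x"
        unfolding map_eq_conv by blast
      then show False by (cases "e x") auto
    qed
  qed
  then have "set xs = set vs"
    using vs(2) P(1) xs(2) by blast
  then have "represents k S \<tau> xs P"
    using represents_permute[OF S vs(3)] xs(1) vs(1) by (simp add: set_eq_iff_mset_eq_distinct)
  then obtain R where R: "(map \<tau> xs, R) \<in> EO5 k S" "\<And>e. P e \<longleftrightarrow> map e xs \<in> R"
    by (auto simp: represents_def)
  \<comment> \<open>Knowledge about assignments passes to tuples because each tuple of this length
    is realised by an assignment.\<close>
  have "R = {t. length t = length xs \<and> t \<noteq> c}"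
  proof (intro set_eqI iffI)
    fix t assume t: "t \<in> R"
    then have "length t = length xs"
      using EO5_length[OF S R(1)] by simp
    with t R(2) P_iff assignment show "t \<in> {t. length t = length xs \<and> t \<noteq> c}"
      by blast
  qed (use R(2) P_iff assignment in blast)
  then show ?thesis
    using R(1) ex \<rho>_eq by simp
qed

section \<open>The tuple excluded by a relation of type (c7)\<close>

lemma concat_blocks_surj:
  assumes "length l = (\<Sum>t<n. m t)"
  shows "\<exists>x. l = concat (map (\<lambda>t. map (x t) [0..<m t]) [0..<n])"
  using assms
proof (induction n arbitrary: l)
  case (Suc n)
  let ?N = "\<Sum>t<n. m t"
  obtain x where x: "take ?N l = concat (map (\<lambda>t. map (x t) [0..<m t]) [0..<n])"
    using Suc.IH[of "take ?N l"] Suc.prems by auto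
  \<comment> \<open>Row \<open>n\<close> reads the last block, which starts at position
    \<open>?N\<close>; rows below \<open>n\<close> keep their values.\<close>
  let ?x = "x(n := (!) (drop ?N l))"
  have "drop ?N l = map (?x n) [0..<m n]"
    using Suc.prems by (intro nth_equalityI) auto
  moreover have "take ?N l = concat (map (\<lambda>t. map (?x t) [0..<m t]) [0..<n])"
    unfolding x by (intro arg_cong[of _ _ concat] map_cong) auto
  ultimately have "l = concat (map (\<lambda>t. map (?x t) [0..<m t]) [0..<n]) @ map (?x n) [0..<m n]"
    by (metis append_take_drop_id)
  also have "\<dots> = concat (map (\<lambda>t. map (?x t) [0..<m t]) [0..<Suc n])"
    by simp
  finally have "l = concat (map (\<lambda>t. map (?x t) [0..<m t]) [0..<Suc n])" .
  then show ?case by blast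
qed simp

text \<open>A disjunction fails only if all its disjuncts do, and over two values this determines
  every variable.\<close>

lemma c7_coatom:
  assumes "\<rho> \<in> c7 k"
  shows "\<exists>c. length c = length (fst \<rho>) \<and> snd \<rho> = {t. length t = length (fst \<rho>) \<and> t \<noteq> c}"
proof -
  obtain n m s b where \<rho>: "\<rho> = (concat (map (\<lambda>t. replicate (m t) (s t)) [0..<n]),
      {concat (map (\<lambda>t. map (x t) [0..<m t]) [0..<n]) | x. \<exists>t<n. \<exists>p<m t. x t p = b t})"
    using assms by (auto simp: c7_def)
  define f where "f x = concat (map (\<lambda>t. map (x t) [0..<m t]) [0..<n])"
    for x :: "nat \<Rightarrow> nat \<Rightarrow> bit"
  \<comment> \<open>Adding 1 picks the value other than \<open>b t\<close>, so \<open>?c\<close>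
    falsifies every disjunct.\<close>
  let ?c = "f (\<lambda>t p. b t + 1)"
  have len: "length (f x) = (\<Sum>t<n. m t)" for x
    unfolding f_def by (induction n) auto
  have len_\<rho>: "length (fst \<rho>) = (\<Sum>t<n. m t)"
    unfolding \<rho> by (induction n) auto
  have bit: "z = y + 1 \<longleftrightarrow> z \<noteq> y" for z y :: bit
    by (cases z; cases y) auto
  have eq: "f x = ?c \<longleftrightarrow> (\<forall>t<n. \<forall>p<m t. x t p = b t + 1)" for x
  proof
    assume "f x = ?c"
    \<comment> \<open>Corresponding blocks have equal lengths, so equal concatenations have equal
      blocks.\<close>
    then have "map (\<lambda>t. map (x t) [0..<m t]) [0..<n] = map (\<lambda>t. map (\<lambda>p. b t + 1) [0..<m t]) [0..<n]"
      unfolding f_def by (rule concat_injective) (auto simp: set_zip)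
    then show "\<forall>t<n. \<forall>p<m t. x t p = b t + 1"
      by (auto simp: map_eq_conv)
  qed (auto simp: f_def intro!: arg_cong[of _ _ concat] map_cong)
  have iff: "f x \<noteq> ?c \<longleftrightarrow> (\<exists>t<n. \<exists>p<m t. x t p = b t)" for x
    unfolding eq bit by blast
  have "snd \<rho> = {f x | x. f x \<noteq> ?c}"
    unfolding iff by (simp add: \<rho> f_def)
  also have "\<dots> = {t. (\<exists>x. t = f x) \<and> t \<noteq> ?c}"
    by auto
  also have "\<dots> = {t. length t = length (fst \<rho>) \<and> t \<noteq> ?c}"
  proof -
    have "(\<exists>x. t = f x) \<longleftrightarrow> length t = length (fst \<rho>)" for t
      using concat_blocks_surj[of t m n] len by (auto simp: len_\<rho> f_def)
    then show ?thesis by simp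
  qed
  finally show ?thesis
    using len[of "\<lambda>t p. b t + 1"] len_\<rho> by (intro exI[of _ ?c] conjI) simp_all
qed

text \<open>Permuting coordinates is a bijection on the tuples of a given length, so the missing
  tuple is simply carried along.\<close>

lemma permute_rel_coatom:
  assumes \<pi>: "\<pi> permutes {..<length (fst \<rho>)}"
    and c: "length c = length (fst \<rho>)" "snd \<rho> = {t. length t = length (fst \<rho>) \<and> t \<noteq> c}"
  shows "snd (permute_rel \<pi> \<rho>) =
    {t. length t = length (fst (permute_rel \<pi> \<rho>)) \<and> t \<noteq> permute_list \<pi> c}" (is "?L = ?R")
proof (intro set_eqI iffI)
  fix t assume "t \<in> ?L"
  then obtain u where u: "t = permute_list \<pi> u" "length u = length c" "u \<noteq> c"
    using c by (auto simp: permute_rel_def)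
  then show "t \<in> ?R"
    using permute_list_inj[of \<pi> u c] \<pi> c(1) by (auto simp: permute_rel_def)
next
  fix t assume t: "t \<in> ?R"
  then obtain u where "length u = length t" "permute_list \<pi> u = t"
    using permute_list_surj[of \<pi> t] \<pi> by (auto simp: permute_rel_def)
  with t show "t \<in> ?L"
    using c by (auto simp: permute_rel_def)
qed

lemma up_to_order_c7_coatom:
  assumes "\<rho> \<in> up_to_order (c7 k)"
  shows "\<exists>c. length c = length (fst \<rho>) \<and> snd \<rho> = {t. length t = length (fst \<rho>) \<and> t \<noteq> c}"
proof -
  obtain \<pi> \<rho>' where \<rho>: "\<rho> = permute_rel \<pi> \<rho>'" "\<rho>' \<in> c7 k" "\<pi> permutes {..<length (fst \<rho>')}"
    using assms by (auto simp: up_to_order_def)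
  obtain c where c: "length c = length (fst \<rho>')"
      "snd \<rho>' = {t. length t = length (fst \<rho>') \<and> t \<noteq> c}"
    using c7_coatom[OF \<rho>(2)] by blast
  show ?thesis
    unfolding \<rho>(1) using permute_rel_coatom[OF \<rho>(3) c] c(1)
    by (intro exI[of _ "permute_list \<pi> c"]) (simp add: permute_rel_def)
qed

section \<open>Finiteness\<close>

lemma finite_up_to_order:
  assumes "finite C"
  shows "finite (up_to_order C)"
proof -
  have "up_to_order C = (\<Union>\<rho>\<in>C. (\<lambda>\<pi>. permute_rel \<pi> \<rho>) ` {\<pi>. \<pi> permutes {..<length (fst \<rho>)}})"
    unfolding up_to_order_def by blast
  then show ?thesis
    using assms by (simp add: finite_permutations)
qed

text \<open>Each type is parametrised by finitely many sorts and bits; in (c6) the distinctness of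
  the sorts bounds the arity by \<open>k\<close>.\<close>

lemma finite_c1_to_c6: "finite (c1 k \<union> c2 k \<union> c3 k \<union> c4 k \<union> c5 k \<union> c6 k)"
proof -
  have sorts: "finite (sorts k)" by (simp add: sorts_def)
  have "(UNIV :: bit set) = {0, 1}"
    by (auto intro: bit.exhaust)
  then have bit: "finite (UNIV :: bit set)"
    by (metis finite.emptyI finite.insertI)
  have lists: "finite {ss. set ss \<subseteq> sorts k \<and> distinct ss}"
    using sorts by (rule finite_subset_distinct)
  have "finite (c1 k)" "finite (c4 k)"
    unfolding c1_def c4_def using sorts by simp_all
  moreover have "c2 k \<subseteq> (\<lambda>(i, j, b). ([i, i, j], {[x, y, u] | x y u. x = y \<or> u = b}))
      ` (sorts k \<times> sorts k \<times> UNIV)"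
    by (force simp: c2_def)
  then have "finite (c2 k)"
    using sorts bit finite_subset by blast
  moreover have "c3 k \<subseteq>
      (\<lambda>(i, j). ([i, i, j, j], {[x, y, u, v] | x y u v. x = y \<or> u = v})) ` (sorts k \<times> sorts k)
      \<union> (\<lambda>i. ([i, i, i], {[x, y, z] | x y z. x = y \<or> y = z})) ` sorts k"
    unfolding c3_def by force
  then have "finite (c3 k)"
    using sorts finite_subset by blast
  moreover have "c5 k \<subseteq>
      (\<lambda>(i, j). ([i, i, j, j], {[x, y, u, v] | x y u v. x + y = u + v})) ` (sorts k \<times> sorts k)"
    unfolding c5_def by force
  then have "finite (c5 k)"
    using sorts finite_subset by blast
  moreover have "c6 k \<subseteq> (\<lambda>(ss, b). (ss, {t. length t = length ss \<and> sum_list t = b}))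
      ` ({ss. set ss \<subseteq> sorts k \<and> distinct ss} \<times> UNIV)"
    unfolding c6_def by force
  then have "finite (c6 k)"
    using lists bit finite_subset by blast
  ultimately show ?thesis by simp
qed

theorem theorem4p7:
  fixes k :: nat and S :: "srel set"
  assumes "S \<subseteq> srels k"
  shows "(\<forall>\<rho>. canonical k \<rho> \<and> \<rho> \<in> qpp k S \<and> \<rho> \<notin> EO5 k S \<longrightarrow> \<not> canonical_c7 k \<rho>)
    \<and> finite {\<rho>. canonical k \<rho> \<and> \<rho> \<in> qpp k S \<and> \<rho> \<notin> EO5 k S}"
proof
  have not_c7: "\<rho> \<notin> up_to_order (c7 k)" if "\<rho> \<in> qpp k S" "\<rho> \<notin> EO5 k S" for \<rho>
    using up_to_order_c7_coatom qpp_coatom_in_EO5[OF assms that(1)] that(2) by blast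
  then show "\<forall>\<rho>. canonical k \<rho> \<and> \<rho> \<in> qpp k S \<and> \<rho> \<notin> EO5 k S \<longrightarrow> \<not> canonical_c7 k \<rho>"
    by (auto simp: canonical_c7_def)
  \<comment> \<open>With (c7) excluded, such a relation is a reordering of one of types (c1) to
    (c6).\<close>
  have "{\<rho>. canonical k \<rho> \<and> \<rho> \<in> qpp k S \<and> \<rho> \<notin> EO5 k S}
      \<subseteq> up_to_order (c1 k \<union> c2 k \<union> c3 k \<union> c4 k \<union> c5 k \<union> c6 k)"
    using not_c7 by (fastforce simp: canonical_def up_to_order_def)
  then show "finite {\<rho>. canonical k \<rho> \<and> \<rho> \<in> qpp k S \<and> \<rho> \<notin> EO5 k S}"
    using finite_up_to_order[OF finite_c1_to_c6] finite_subset by blast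
qed

end
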